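(* Let $n\in\mathbb{N}$ and let $A$ be an $n\times n$ acyclic real symmetric matrix. Suppose $\lambda$ is an eigenvalue of $A$ of multiplicity $k$ and $U=\{u_1,\ldots,u_k\}$ is a $\lambda$-star set of $A$. For $i\in[k]$ let $U_i=U\setminus\{u_i\}$ and let $A_i$ be the principal submatrix of $A-U_i$ corresponding to the connected component of $G(A-U_i)$ containing $u_i$. Define $\boldsymbol{\alpha}_i\in\mathbb{R}^n$ by \[ \boldsymbol{\alpha}_i(v)=\begin{cases} W(P_{u_i,v})\,\phi(A_i-P_{u_i,v},\lambda) & \text{if } v \text{ is an index of } A_i,\\ 0 & \text{otherwise}.\end{cases} \] Then $\boldsymbol{\alpha}_1,\ldots,\boldsymbol{\alpha}_k$ are $k$ linearly independent $\lambda$-eigenvectors of $A$.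
   Context: $[n]=\{1,\ldots,n\}$. For a real symmetric matrix $A$ with rows/columns indexed by a set $I$, its graph $G(A)$ has vertex set $I$, with $u\neq v$ adjacent iff $A_{uv}\neq 0$; edge $uv$ has weight $w(uv)=A_{uv}$. $A$ is called acyclic if $G(A)$ is a forest. For $u,v$ in the same component, $P_{u,v}$ is the unique path between them (a single vertex if $u=v$), and $W(P_{u,v})$ is the product of the weights of its edges ($1$ if $u=v$). For an index set $U$, $A-U$ is the matrix obtained by deleting the rows and columns indexed by $U$. $\phi(B,\lambda)=\det(\lambda\mathbb{I}-B)$, with $\phi$ of the empty matrix equal to $1$. If $\lambda$ is an eigenvalue of $A$ of multiplicity $k$, a set $U$ of indices is a $\lambda$-star set if $|U|=k$ and $\lambda$ is not an eigenvalue of $A-U$. *)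

theory Defs
  imports "Jordan_Normal_Form.Char_Poly" "Jordan_Normal_Form.DL_Submatrix"
begin

text \<open>Matrices are JNF matrices of type real mat; indices are 0..<n.
  Graph notions are stated on the original index labels.\<close>

definition phi :: "real mat \<Rightarrow> real \<Rightarrow> real" where
  "phi B lam = det (lam \<cdot>\<^sub>m 1\<^sub>m (dim_row B) - B)"

definition principal :: "real mat \<Rightarrow> nat set \<Rightarrow> real mat" where
  "principal A S = submatrix A S S"

definition adj :: "real mat \<Rightarrow> nat \<Rightarrow> nat \<Rightarrow> bool" where
  "adj A u v \<longleftrightarrow> u \<noteq> v \<and> A $$ (u, v) \<noteq> 0"

definition is_path :: "real mat \<Rightarrow> nat set \<Rightarrow> nat list \<Rightarrow> bool" where
  "is_path A S xs \<longleftrightarrow> xs \<noteq> [] \<and> distinct xs \<and> set xs \<subseteq> S \<and>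
     (\<forall>i. Suc i < length xs \<longrightarrow> adj A (xs ! i) (xs ! Suc i))"

definition is_cycle :: "real mat \<Rightarrow> nat set \<Rightarrow> nat list \<Rightarrow> bool" where
  "is_cycle A S xs \<longleftrightarrow> is_path A S xs \<and> length xs \<ge> 3 \<and> adj A (last xs) (hd xs)"

definition acyclic_mat :: "real mat \<Rightarrow> bool" where
  "acyclic_mat A \<longleftrightarrow> \<not> (\<exists>xs. is_cycle A {0..<dim_row A} xs)"

definition component :: "real mat \<Rightarrow> nat set \<Rightarrow> nat \<Rightarrow> nat set" where
  "component A S u = {v. \<exists>xs. is_path A S xs \<and> hd xs = u \<and> last xs = v}"

text \<open>The unique path between u and v inside S (meaningful in a forest).\<close>
definition the_path :: "real mat \<Rightarrow> nat set \<Rightarrow> nat \<Rightarrow> nat \<Rightarrow> nat list" where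
  "the_path A S u v = (THE xs. is_path A S xs \<and> hd xs = u \<and> last xs = v)"

definition path_weight :: "real mat \<Rightarrow> nat list \<Rightarrow> real" where
  "path_weight A xs = (\<Prod>i<length xs - 1. A $$ (xs ! i, xs ! Suc i))"

definition multiplicity :: "real mat \<Rightarrow> real \<Rightarrow> nat" where
  "multiplicity A lam = order lam (char_poly A)"

definition star_set :: "real mat \<Rightarrow> real \<Rightarrow> nat set \<Rightarrow> bool" where
  "star_set A lam U \<longleftrightarrow> U \<subseteq> {0..<dim_row A} \<and> card U = multiplicity A lam \<and>
     \<not> eigenvalue (principal A ({0..<dim_row A} - U)) lam"

definition alpha :: "real mat \<Rightarrow> real \<Rightarrow> nat set \<Rightarrow> nat \<Rightarrow> real vec" where
  "alpha A lam U u = (let n = dim_row A; C = component A ({0..<n} - (U - {u})) u in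
     vec n (\<lambda>v. if v \<in> C then
        (let P = the_path A C u v in path_weight A P * phi (principal A (C - set P)) lam)
      else 0))"

end

theory Submission
  imports Defs "HOL-Combinatorics.Cycles"
    "Jordan_Normal_Form.Jordan_Normal_Form_Existence"
    "Jordan_Normal_Form.Jordan_Normal_Form_Uniqueness"
begin

text \<open>
  Put \<open>M = \<lambda>I - A\<close> and root the component of \<open>u\<^sub>i\<close> at \<open>u\<^sub>i\<close>. For a vertex \<open>w \<noteq> u\<^sub>i\<close> with parent \<open>p\<close>,
  row \<open>w\<close> of \<open>M \<alpha>\<^sub>i = 0\<close> is, up to the factor \<open>W(P\<^bsub>u,w\<^esub>)\<close>, the expansion of the characteristic
  polynomial of the forest \<open>A\<^sub>i - P\<^bsub>u,p\<^esub>\<close> at \<open>w\<close>: in the Leibniz formula only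
  permutations that fix \<open>w\<close> or swap it with a neighbour survive, since longer orbits would be cycles.

  So all rows outside \<open>U\<close> vanish, and this suffices. By symmetry the kernel of \<open>M\<close> has dimension
  \<open>k\<close>; because \<open>M\<close> restricted to the complement of \<open>U\<close> is invertible, a solution of the rows
  outside \<open>U\<close> is determined by its \<open>k\<close> entries on \<open>U\<close>, so these solutions form exactly the kernel.

  Finally \<open>\<alpha>\<^sub>i(u\<^sub>j) = 0\<close> for \<open>j \<noteq> i\<close>, and \<open>\<alpha>\<^sub>i(u\<^sub>i)\<close> is a factor of the determinant of that
  invertible restriction, hence nonzero.
\<close>

section \<open>Determinants over index sets\<close>

text \<open>Determinants indexed by arbitrary finite sets of labels make vertex deletion a set
  difference, with no renumbering of rows and columns.\<close>

definition set_det :: "('a \<Rightarrow> 'a \<Rightarrow> real) \<Rightarrow> 'a set \<Rightarrow> real" where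
  "set_det M X = (\<Sum>p | p permutes X. of_int (sign p) * (\<Prod>i\<in>X. M i (p i)))"

lemma set_det_empty [simp]: "set_det M {} = 1"
  by (simp add: set_det_def)

text \<open>Conjugation by the bijection carries permutations of \<open>X\<close> to permutations of
  \<open>Y\<close> and keeps the sign. With \<open>f = pick S\<close> this leads from matrix
  positions back to the original labels.\<close>

lemma set_det_reindex:
  assumes f: "bij_betw f X Y" and fin: "finite X"
  shows "set_det M Y = set_det (\<lambda>i j. M (f i) (f j)) X"
proof -
  let ?F = "\<lambda>\<pi> x. if x \<in> Y then f (\<pi> (inv_into X f x)) else x"
  have inj: "inj_on f X" and im: "f ` X = Y"
    using f by (auto simp: bij_betw_def)
  have "set_det M Y = (\<Sum>p | p permutes X. of_int (sign (?F p)) * (\<Prod>i\<in>Y. M i (?F p i)))"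
    unfolding set_det_def by (rule sum.reindex_bij_betw[OF bij_betw_permutations[OF f], symmetric])
  also have "\<dots> = set_det (\<lambda>i j. M (f i) (f j)) X"
    unfolding set_det_def
  proof (rule sum.cong[OF refl])
    fix p assume "p \<in> {p. p permutes X}"
    then have p: "p permutes X" by simp
    have "?F p = map_permutation X f p"
      by (auto simp: map_permutation_def restrict_id_def im fun_eq_iff)
    then have "sign (?F p) = sign p"
      using sign_map_permutation[OF inj p fin] by simp
    moreover have "(\<Prod>i\<in>Y. M i (?F p i)) = (\<Prod>i\<in>X. M (f i) (?F p (f i)))"
      by (rule prod.reindex_bij_betw[OF f, symmetric])
    moreover have "\<dots> = (\<Prod>i\<in>X. M (f i) (f (p i)))"
      using im inj by (intro prod.cong) (auto simp: inv_into_f_f)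
    ultimately show "of_int (sign (?F p)) * (\<Prod>i\<in>Y. M i (?F p i))
        = of_int (sign p) * (\<Prod>i\<in>X. M (f i) (f (p i)))" by simp
  qed
  finally show ?thesis .
qed

lemma sum_permutations_fixing:
  fixes M :: "'a \<Rightarrow> 'a \<Rightarrow> real"
  assumes fin: "finite X" and w: "w \<in> X"
  shows "(\<Sum>p | p permutes X \<and> p w = w. of_int (sign p) * (\<Prod>i\<in>X. M i (p i)))
         = M w w * set_det M (X - {w})"
proof -
  have "{p. p permutes X \<and> p w = w} = {p. p permutes (X - {w})}"
    using w by (auto simp: permutes_def)
  moreover have "(\<Prod>i\<in>X. M i (p i)) = M w w * (\<Prod>i\<in>X - {w}. M i (p i))"
    if "p permutes (X - {w})" for p
    using prod.remove[OF fin w, of "\<lambda>i. M i (p i)"] permutes_not_in[OF that, of w] by simp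
  ultimately show ?thesis
    by (simp add: set_det_def sum_distrib_left algebra_simps)
qed

text \<open>Composition with the transposition of \<open>w\<close> and \<open>c\<close> is a
  bijection from the permutations of \<open>X - {w, c}\<close> to those that swap the two points; it
  flips the sign.\<close>

lemma sum_permutations_swapping:
  fixes M :: "'a \<Rightarrow> 'a \<Rightarrow> real"
  assumes fin: "finite X" and w: "w \<in> X" and c: "c \<in> X" and wc: "c \<noteq> w"
  shows "(\<Sum>p | p permutes X \<and> p w = c \<and> p c = w. of_int (sign p) * (\<Prod>i\<in>X. M i (p i)))
         = - (M w c * M c w * set_det M (X - {w, c}))"
proof -
  let ?t = "transpose w c" and ?Z = "X - {w, c}"
  have t: "?t permutes X" using w c by (rule permutes_swap_id)
  have fix_wc: "q w = w" "q c = c" if "q permutes ?Z" for q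
    using that by (auto simp: permutes_def)
  have fwd: "?t \<circ> q \<in> {p. p permutes X \<and> p w = c \<and> p c = w}" if "q permutes ?Z" for q
  proof -
    have "q permutes X" using that by (rule permutes_subset) auto
    then show ?thesis using fix_wc[OF that] permutes_compose[OF _ t] by auto
  qed
  have bwd: "?t \<circ> p permutes ?Z" if p: "p permutes X" "p w = c" "p c = w" for p
  proof -
    have "?t \<circ> p permutes X" by (rule permutes_compose[OF p(1) t])
    then show ?thesis
      by (rule permutes_superset) (auto simp: p wc)
  qed
  have tt: "?t \<circ> (?t \<circ> q) = q" for q :: "'a \<Rightarrow> 'a"
    by (simp add: fun_eq_iff)
  have bij: "bij_betw (\<lambda>q. ?t \<circ> q) {q. q permutes ?Z} {p. p permutes X \<and> p w = c \<and> p c = w}"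
    by (rule bij_betw_byWitness[of _ "\<lambda>p. ?t \<circ> p"]) (use fwd bwd tt in auto)
  have "(\<Sum>p | p permutes X \<and> p w = c \<and> p c = w. of_int (sign p) * (\<Prod>i\<in>X. M i (p i)))
      = (\<Sum>q | q permutes ?Z. of_int (sign (?t \<circ> q)) * (\<Prod>i\<in>X. M i ((?t \<circ> q) i)))"
    by (rule sum.reindex_bij_betw[OF bij, symmetric])
  also have "\<dots> = (\<Sum>q | q permutes ?Z. - (M w c * M c w) * (of_int (sign q) * (\<Prod>i\<in>?Z. M i (q i))))"
  proof (rule sum.cong[OF refl])
    fix q assume "q \<in> {q. q permutes ?Z}"
    then have q: "q permutes ?Z" by simp
    have "permutation q" using q fin by (meson finite_Diff permutation_permutes)
    then have sg: "sign (?t \<circ> q) = - sign q"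
      using wc by (simp add: sign_compose permutation_swap_id sign_swap_id)
    have other: "(?t \<circ> q) i = q i" if "i \<in> ?Z" for i
    proof -
      have "q i \<in> ?Z" using permutes_in_image[OF q] that by simp
      then show ?thesis by auto
    qed
    have X: "X = insert w (insert c ?Z)" using w c by auto
    have "(\<Prod>i\<in>X. M i ((?t \<circ> q) i)) = M w c * (M c w * (\<Prod>i\<in>?Z. M i ((?t \<circ> q) i)))"
      by (subst X) (use fin wc fix_wc[OF q] in simp)
    also have "(\<Prod>i\<in>?Z. M i ((?t \<circ> q) i)) = (\<Prod>i\<in>?Z. M i (q i))"
      using other by (intro prod.cong) auto
    finally show "of_int (sign (?t \<circ> q)) * (\<Prod>i\<in>X. M i ((?t \<circ> q) i))
        = - (M w c * M c w) * (of_int (sign q) * (\<Prod>i\<in>?Z. M i (q i)))"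
      by (simp add: sg)
  qed
  also have "\<dots> = - (M w c * M c w * set_det M ?Z)"
    by (simp add: set_det_def sum_distrib_left sum_negf)
  finally show ?thesis .
qed

text \<open>The Leibniz sum is sorted by the orbit of \<open>w\<close>: a fixed point, a 2-cycle
  with some \<open>c\<close>, or a longer orbit. The hypothesis kills every term of the last
  kind.\<close>

lemma set_det_expand:
  assumes fin: "finite X" and w: "w \<in> X"
    and no_long_cycle: "\<And>p. p permutes X \<Longrightarrow> p w \<noteq> w \<Longrightarrow> p (p w) \<noteq> w \<Longrightarrow> \<exists>i\<in>X. M i (p i) = 0"
  shows "set_det M X = M w w * set_det M (X - {w})
          - (\<Sum>c\<in>X - {w}. M w c * M c w * set_det M (X - {w, c}))"
proof -
  let ?f = "\<lambda>p. of_int (sign p) * (\<Prod>i\<in>X. M i (p i)) :: real"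
  let ?P = "{p. p permutes X}" and ?F = "{p. p permutes X \<and> p w = w}"
  let ?S = "\<lambda>c. {p. p permutes X \<and> p w = c \<and> p c = w}"
  have finP: "finite ?P" using fin by (rule finite_permutations)
  have fins: "finite {p. p permutes X \<and> Q p}" for Q
    by (rule finite_subset[OF _ finP]) auto
  have sub: "?F \<union> (\<Union>c\<in>X - {w}. ?S c) \<subseteq> ?P" by auto
  have "set_det M X = sum ?f (?F \<union> (\<Union>c\<in>X - {w}. ?S c))"
    unfolding set_det_def
  proof (rule sum.mono_neutral_right[OF finP sub], rule ballI)
    fix p assume "p \<in> ?P - (?F \<union> (\<Union>c\<in>X - {w}. ?S c))"
    then have p: "p permutes X" and "p \<notin> (\<Union>c\<in>X - {w}. ?S c)" and "p w \<noteq> w"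
      by auto
    moreover have "p w \<in> X" using p w by (simp add: permutes_in_image)
    ultimately have "p (p w) \<noteq> w" by auto
    from no_long_cycle[OF p \<open>p w \<noteq> w\<close> this] show "?f p = 0"
      using fin by auto
  qed
  also have "\<dots> = sum ?f ?F + sum ?f (\<Union>c\<in>X - {w}. ?S c)"
    by (rule sum.union_disjoint) (use fins fin in auto)
  also have "sum ?f (\<Union>c\<in>X - {w}. ?S c) = (\<Sum>c\<in>X - {w}. sum ?f (?S c))"
    by (rule sum.UNION_disjoint) (use fins fin in auto)
  also have "\<dots> = (\<Sum>c\<in>X - {w}. - (M w c * M c w * set_det M (X - {w, c})))"
    by (rule sum.cong[OF refl]) (rule sum_permutations_swapping[OF fin w], auto)
  finally show ?thesis
    by (simp add: sum_permutations_fixing[OF fin w] sum_negf)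
qed

section \<open>From principal submatrices to index sets\<close>

lemma bij_betw_pick:
  assumes finS: "finite S"
  shows "bij_betw (pick S) {0..<card S} S"
proof -
  have pick_inj: "inj_on (pick S) {0..<card S}"
  proof (rule inj_onI)
    fix x y assume xy: "x \<in> {0..<card S}" "y \<in> {0..<card S}" and eq: "pick S x = pick S y"
    show "x = y" using card_pick[of x S] card_pick[of y S] xy unfolding eq by simp
  qed
  moreover have "pick S ` {0..<card S} = S"
    by (rule card_subset_eq[OF finS])
      (use pick_in_set in \<open>auto simp: card_image[OF pick_inj]\<close>)
  ultimately show ?thesis by (simp add: bij_betw_def)
qed

lemma principal_carrier_entry:
  assumes A: "A \<in> carrier_mat n n" and S: "S \<subseteq> {0..<n}"
  shows "principal A S \<in> carrier_mat (card S) (card S)"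
    and "i < card S \<Longrightarrow> j < card S \<Longrightarrow> principal A S $$ (i, j) = A $$ (pick S i, pick S j)"
proof -
  have card: "{i. i < n \<and> i \<in> S} = S" using S by auto
  show "principal A S \<in> carrier_mat (card S) (card S)"
    unfolding principal_def using A card by (intro carrier_matI) (simp_all add: dim_submatrix)
  show "i < card S \<Longrightarrow> j < card S \<Longrightarrow> principal A S $$ (i, j) = A $$ (pick S i, pick S j)"
    unfolding principal_def using A card by (subst submatrix_index) simp_all
qed

lemma phi_principal:
  assumes A: "A \<in> carrier_mat n n" and S: "S \<subseteq> {0..<n}"
  shows "phi (principal A S) lam = set_det (\<lambda>i j. (if i = j then lam else 0) - A $$ (i, j)) S"
proof -
  have finS: "finite S" using S by (rule finite_subset) simp
  note bij = bij_betw_pick[OF finS]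
  note dims = principal_carrier_entry(1)[OF A S]
  let ?B = "lam \<cdot>\<^sub>m 1\<^sub>m (dim_row (principal A S)) - principal A S"
  have B: "?B \<in> carrier_mat (card S) (card S)" using dims by auto
  have ent: "?B $$ (i, j) = (if pick S i = pick S j then lam else 0) - A $$ (pick S i, pick S j)"
    if "i < card S" "j < card S" for i j
  proof -
    \<comment> \<open>Injectivity of \<open>pick S\<close> makes the diagonal of the submatrix match
      the diagonal in the original labels.\<close>
    have "pick S i = pick S j \<longleftrightarrow> i = j"
      using inj_on_eq_iff[OF bij_betw_imp_inj_on[OF bij], of i j] that by simp
    then show ?thesis using that dims principal_carrier_entry(2)[OF A S that] by simp
  qed
  have "phi (principal A S) lam = set_det (\<lambda>i j. ?B $$ (i, j)) {0..<card S}"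
    unfolding phi_def det_def'[OF B] set_det_def
    by (rule sum.cong) (simp_all add: sign_def)
  also have "\<dots> = set_det (\<lambda>i j. (if pick S i = pick S j then lam else 0) - A $$ (pick S i, pick S j)) {0..<card S}"
    unfolding set_det_def
  proof (rule sum.cong[OF refl])
    fix p assume "p \<in> {p. p permutes {0..<card S}}"
    then have p: "p permutes {0..<card S}" by simp
    have lt: "p i < card S" if "i < card S" for i
      using permutes_in_image[OF p, of i] that by simp
    have "(\<Prod>i\<in>{0..<card S}. ?B $$ (i, p i)) = (\<Prod>i\<in>{0..<card S}.
        (if pick S i = pick S (p i) then lam else 0) - A $$ (pick S i, pick S (p i)))"
      by (rule prod.cong[OF refl], rule ent) (simp_all add: lt)
    then show "of_int (sign p) * (\<Prod>i\<in>{0..<card S}. ?B $$ (i, p i))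
      = of_int (sign p) * (\<Prod>i\<in>{0..<card S}.
        (if pick S i = pick S (p i) then lam else 0) - A $$ (pick S i, pick S (p i)))"
      by simp
  qed
  also have "\<dots> = set_det (\<lambda>i j. (if i = j then lam else 0) - A $$ (i, j)) S"
    by (rule set_det_reindex[OF bij, symmetric]) simp
  finally show ?thesis .
qed

section \<open>Kernels of real symmetric matrices\<close>

text \<open>By symmetry the squared norm of \<open>M x\<close> is the scalar product of
  \<open>M (M x)\<close> with \<open>x\<close>. This will exclude Jordan blocks of size two or
  more.\<close>

lemma symmetric_mult_twice_zero:
  fixes M :: "real mat"
  assumes M: "M \<in> carrier_mat n n" and sym: "M\<^sup>T = M" and x: "x \<in> carrier_vec n"
    and zero: "M *\<^sub>v (M *\<^sub>v x) = 0\<^sub>v n"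
  shows "M *\<^sub>v x = 0\<^sub>v n"
proof -
  let ?y = "M *\<^sub>v x"
  have y: "?y \<in> carrier_vec n" using M x by auto
  have "?y \<bullet> ?y = (M\<^sup>T *\<^sub>v ?y) \<bullet> x"
    using transpose_vec_mult_scalar[OF M x y] by simp
  also have "\<dots> = 0" using zero x by (simp add: sym)
  finally have "(\<Sum>i<n. (?y $ i)\<^sup>2) = 0"
    unfolding scalar_prod_def carrier_vecD[OF y] by (simp add: power2_eq_square atLeast0LessThan del: index_mult_mat_vec)
  then have sq: "\<forall>i<n. (?y $ i)\<^sup>2 = 0"
    by (simp add: sum_nonneg_eq_0_iff)
  show ?thesis
    by (rule eq_vecI) (use sq y M in auto)
qed

section \<open>Complexification and Jordan block sizes\<close>

lemma complex_mult_vec_Re_Im: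
  fixes M :: "real mat"
  assumes M: "M \<in> carrier_mat m n" and y: "y \<in> carrier_vec n"
  shows "map_vec Re (map_mat of_real M *\<^sub>v y) = M *\<^sub>v map_vec Re y"
    and "map_vec Im (map_mat of_real M *\<^sub>v y) = M *\<^sub>v map_vec Im y"
  using assms by (auto intro!: eq_vecI sum.cong simp: scalar_prod_def)

lemma complex_vec_eq_0_iff:
  assumes "y \<in> carrier_vec n"
  shows "y = 0\<^sub>v n \<longleftrightarrow> map_vec Re y = 0\<^sub>v n \<and> map_vec Im y = 0\<^sub>v n"
  using assms by (auto simp: vec_eq_iff complex_eq_iff)

lemma complex_mult_vec_zero_iff:
  fixes M :: "real mat"
  assumes M: "M \<in> carrier_mat m n" and y: "y \<in> carrier_vec n"
  shows "map_mat of_real M *\<^sub>v y = 0\<^sub>v m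
    \<longleftrightarrow> M *\<^sub>v map_vec Re y = 0\<^sub>v m \<and> M *\<^sub>v map_vec Im y = 0\<^sub>v m"
  by (subst complex_vec_eq_0_iff[of _ m]) (use M y in \<open>auto simp: complex_mult_vec_Re_Im[OF M y]\<close>)

text \<open>Termwise \<open>min 1 x\<close> is at most \<open>min 2 x\<close>, so equal sums force
  every entry to be at most 1. The entries will be Jordan block sizes.\<close>

lemma sum_list_min_stable:
  fixes xs :: "nat list"
  assumes "(\<Sum>x\<leftarrow>xs. min (Suc 0) x) = (\<Sum>x\<leftarrow>xs. min 2 x)"
  shows "(\<Sum>x\<leftarrow>xs. min (Suc 0) x) = sum_list xs"
  using assms
proof (induction xs)
  case (Cons x xs)
  have "(\<Sum>x\<leftarrow>xs. min (Suc 0) x) \<le> (\<Sum>x\<leftarrow>xs. min 2 x)"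
    by (rule sum_list_mono) auto
  with Cons show ?case by (auto simp: min_def split: if_splits)
qed simp

text \<open>Geometric and algebraic multiplicity agree: the square of the shifted matrix has no
  larger kernel, so all Jordan blocks for \<open>lam\<close> have size 1. The kernel is taken over
  the complex numbers, where the characteristic polynomial splits and a Jordan form exists.\<close>

lemma symmetric_kernel_dim_eq_order:
  fixes A :: "real mat"
  assumes A: "A \<in> carrier_mat n n" and sym: "A\<^sup>T = A"
  shows "kernel_dim (map_mat complex_of_real (char_matrix A lam)) = Polynomial.order lam (char_poly A)"
proof -
  let ?c = "complex_of_real"
  define M where "M = char_matrix A lam"
  let ?cA = "map_mat ?c A" and ?cM = "map_mat ?c M"
  have M: "M \<in> carrier_mat n n" using A by (simp add: M_def)
  have "A $$ (j, i) = A $$ (i, j)" if "i < n" "j < n" for i j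
    using arg_cong[OF sym, of "\<lambda>B. B $$ (i, j)"] A that by simp
  then have symM: "M\<^sup>T = M"
    using A by (intro eq_matI) (auto simp: M_def char_matrix_def)
  have cA: "?cA \<in> carrier_mat n n" and cM: "?cM \<in> carrier_mat n n" using A M by auto
  have cMM: "?cM * ?cM \<in> carrier_mat n n" using cM by auto
  have cm: "char_matrix ?cA (?c lam) = ?cM"
    using A by (intro eq_matI) (auto simp: M_def char_matrix_def)
  obtain as where "char_poly ?cA = (\<Prod>a\<leftarrow>as. [:- a, 1:])"
    using char_poly_factorized[OF cA] by auto
  then obtain n_as where jnf: "jordan_nf ?cA n_as"
    using jordan_nf_exists[OF cA] by blast
  \<comment> \<open>The sizes of the Jordan blocks that belong to \<open>lam\<close>.\<close>
  let ?xs = "map fst [(n, e)\<leftarrow>n_as . e = ?c lam]"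
  have "mat_kernel (?cM * ?cM) = mat_kernel ?cM"
  proof
    show "mat_kernel ?cM \<subseteq> mat_kernel (?cM * ?cM)"
      by (rule mat_kernel_mult_subset[OF cM cM])
    show "mat_kernel (?cM * ?cM) \<subseteq> mat_kernel ?cM"
    proof
      fix y assume "y \<in> mat_kernel (?cM * ?cM)"
      from mat_kernelD[OF cMM this] have y: "y \<in> carrier_vec n"
        and "?cM *\<^sub>v (?cM *\<^sub>v y) = 0\<^sub>v n" using assoc_mult_mat_vec[OF cM cM] by auto
      then have "M *\<^sub>v (M *\<^sub>v map_vec Re y) = 0\<^sub>v n" "M *\<^sub>v (M *\<^sub>v map_vec Im y) = 0\<^sub>v n"
        using complex_mult_vec_zero_iff[OF M mult_mat_vec_carrier[OF cM y]]
        by (simp_all add: complex_mult_vec_Re_Im[OF M y])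
      then have "?cM *\<^sub>v y = 0\<^sub>v n"
        using symmetric_mult_twice_zero[OF M symM] y complex_mult_vec_zero_iff[OF M y] by simp
      then show "y \<in> mat_kernel ?cM" by (rule mat_kernelI[OF cM y])
    qed
  qed
  then have "kernel_dim (?cM * ?cM) = kernel_dim ?cM"
    unfolding kernel_dim_def using cM by simp
  moreover have "?cM ^\<^sub>m 2 = ?cM * ?cM"
    using cM by (simp add: numeral_2_eq_2)
  moreover have "?cM ^\<^sub>m Suc 0 = ?cM"
    using cM by simp
  ultimately have "dim_gen_eigenspace ?cA (?c lam) (Suc 0) = dim_gen_eigenspace ?cA (?c lam) 2"
    and k: "kernel_dim ?cM = dim_gen_eigenspace ?cA (?c lam) (Suc 0)"
    unfolding dim_gen_eigenspace_def cm by simp_all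
  \<comment> \<open>The kernel of the \<open>k\<close>-th power has dimension the sum of
    \<open>min k x\<close> over the block sizes \<open>x\<close>; agreement for 1 and 2 is what
    \<open>sum_list_min_stable\<close> requires.\<close>
  then have "dim_gen_eigenspace ?cA (?c lam) (Suc 0) = sum_list ?xs"
    unfolding dim_gen_eigenspace[OF jnf] by (intro sum_list_min_stable)
  also have "\<dots> = Polynomial.order (?c lam) (char_poly ?cA)"
    unfolding jordan_nf_order[OF jnf] by (simp add: case_prod_unfold)
  also have "\<dots> = Polynomial.order lam (char_poly A)"
  proof -
    interpret map_poly_inj_idom_divide_hom ?c ..
    show ?thesis by (simp add: of_real_hom.char_poly_hom[OF A] order_hom)
  qed
  finally show ?thesis using k by (simp add: M_def)
qed

text \<open>By \<open>inj\<close>, restriction to the coordinates in \<open>U\<close> is injective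
  on the kernel; as the kernel has dimension \<open>card U\<close>, it is also onto. Some kernel
  vector therefore agrees with \<open>x\<close> on \<open>U\<close>, and \<open>inj\<close> applied
  to the difference shows that it is \<open>x\<close>.\<close>

lemma symmetric_kernel_by_rows:
  fixes A :: "real mat"
  assumes A: "A \<in> carrier_mat n n" and sym: "A\<^sup>T = A"
    and U: "U \<subseteq> {0..<n}" and card: "card U = Polynomial.order lam (char_poly A)"
    and inj: "\<And>z. z \<in> carrier_vec n \<Longrightarrow> (\<And>i. i < n \<Longrightarrow> i \<notin> U \<Longrightarrow> (char_matrix A lam *\<^sub>v z) $ i = 0)
        \<Longrightarrow> (\<And>i. i \<in> U \<Longrightarrow> z $ i = 0) \<Longrightarrow> z = 0\<^sub>v n"
    and x: "x \<in> carrier_vec n"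
    and rows: "\<And>i. i < n \<Longrightarrow> i \<notin> U \<Longrightarrow> (char_matrix A lam *\<^sub>v x) $ i = 0"
  shows "char_matrix A lam *\<^sub>v x = 0\<^sub>v n"
proof -
  let ?c = "complex_of_real"
  define M where "M = char_matrix A lam"
  let ?cM = "map_mat ?c M" and ?k = "card U"
  have M: "M \<in> carrier_mat n n" using A by (simp add: M_def)
  have cM: "?cM \<in> carrier_mat n n" using M by auto
  have injC: "z = 0\<^sub>v n" if z: "z \<in> carrier_vec n"
    and N: "\<And>i. i < n \<Longrightarrow> i \<notin> U \<Longrightarrow> (?cM *\<^sub>v z) $ i = 0" and zU: "\<And>i. i \<in> U \<Longrightarrow> z $ i = 0" for z
  proof -
    have lt: "i < n" if "i \<in> U" for i using that U by auto
    have dim: "dim_vec (?cM *\<^sub>v z) = n" using cM by simp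
    have "(M *\<^sub>v map_vec Re z) $ i = 0" "(M *\<^sub>v map_vec Im z) $ i = 0" if "i < n" "i \<notin> U" for i
      using N[OF that] that dim unfolding complex_mult_vec_Re_Im[OF M z, symmetric] by auto
    then have "map_vec Re z = 0\<^sub>v n" "map_vec Im z = 0\<^sub>v n"
      using z zU lt by (auto intro!: inj simp: M_def)
    then show ?thesis using complex_vec_eq_0_iff[OF z] by simp
  qed
  interpret K: kernel n n ?cM by unfold_locales (rule cM)
  obtain B where finB: "finite B" and basis: "K.basis B"
    using kernel_basis_exists[OF cM] by blast
  have BK: "B \<subseteq> mat_kernel ?cM" and li: "K.lin_indpt B"
    using basis unfolding K.Ker.basis_def by auto
  have "card B = ?k"
    using K.Ker.dim_basis[OF finB basis] symmetric_kernel_dim_eq_order[OF A sym, of lam] card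
    by (simp add: M_def[symmetric])
  then obtain b where b: "bij_betw b {0..<?k} B"
    using ex_bij_betw_nat_finite[OF finB] by auto
  have finU: "finite U" using U by (rule finite_subset) simp
  obtain u where u: "bij_betw u {0..<?k} U"
    using ex_bij_betw_nat_finite[OF finU] by auto
  have un: "u i < n" if "i < ?k" for i using bij_betwE[OF u] that U by fastforce
  \<comment> \<open>The matrix of the restriction to \<open>U\<close>, in the kernel basis
    \<open>b\<close> and the enumeration \<open>u\<close> of \<open>U\<close>.\<close>
  define R where "R = mat ?k ?k (\<lambda>(i, j). b j $ u i)"
  have R: "R \<in> carrier_mat ?k ?k" by (simp add: R_def)
  \<comment> \<open>The kernel vector with coordinates \<open>c\<close>. Linear combinations take
    coefficients indexed by the basis vectors themselves, hence the inverse of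
    \<open>b\<close>.\<close>
  define comb where "comb = (\<lambda>c :: complex vec. K.lincomb (\<lambda>v. c $ (inv_into {0..<?k} b v)) B)"
  have comb_index: "comb c $ i = (\<Sum>j<?k. c $ j * b j $ i)" if "i < n" for c i
  proof -
    have "comb c $ i = (\<Sum>v\<in>B. c $ (inv_into {0..<?k} b v) * v $ i)"
      unfolding comb_def by (rule K.lincomb_index[OF that BK])
    also have "\<dots> = (\<Sum>j\<in>{0..<?k}. c $ (inv_into {0..<?k} b (b j)) * b j $ i)"
      by (rule sum.reindex_bij_betw[OF b, symmetric])
    also have "\<dots> = (\<Sum>j<?k. c $ j * b j $ i)"
      using bij_betw_inv_into_left[OF b] by (intro sum.cong) auto
    finally show ?thesis .
  qed
  have comb_kernel: "comb c \<in> mat_kernel ?cM" for c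
    unfolding comb_def using K.Ker.lincomb_closed[OF BK] by auto
  have comb_U: "comb c $ u i = (R *\<^sub>v c) $ i" if "i < ?k" "c \<in> carrier_vec ?k" for c i
    using that un by (simp add: comb_index R_def scalar_prod_def atLeast0LessThan mult.commute)
  \<comment> \<open>A vector \<open>c\<close> annihilated by \<open>R\<close> yields a kernel vector
    that vanishes on \<open>U\<close>, which is zero by \<open>injC\<close>; independence of the
    basis then gives \<open>c = 0\<close>.\<close>
  have "det R \<noteq> 0"
  proof
    assume "det R = 0"
    then obtain c where c: "c \<in> carrier_vec ?k" "c \<noteq> 0\<^sub>v ?k" "R *\<^sub>v c = 0\<^sub>v ?k"
      using det_0_iff_vec_prod_zero[OF R] by auto
    have "comb c = 0\<^sub>v n"
    proof (rule injC)
      show "comb c \<in> carrier_vec n" using mat_kernelD(1)[OF cM comb_kernel] .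
      show "(?cM *\<^sub>v comb c) $ i = 0" if "i < n" for i
        using mat_kernelD(2)[OF cM comb_kernel, of c] that by simp
      fix i assume "i \<in> U"
      then obtain j where "j < ?k" "i = u j"
        using u by (force simp: bij_betw_def)
      then show "comb c $ i = 0" using comb_U[of j c] c by simp
    qed
    then have "(\<lambda>v. c $ (inv_into {0..<?k} b v)) \<in> B \<rightarrow> {0}"
      unfolding comb_def using K.Ker.not_lindepD[OF li finB] by auto
    then have "c $ (inv_into {0..<?k} b (b j)) = 0" if "j < ?k" for j
      using bij_betwE[OF b] that by auto
    then have "c $ j = 0" if "j < ?k" for j
      using bij_betw_inv_into_left[OF b, of j] that by (metis atLeastLessThan_iff zero_le)
    then have "c = 0\<^sub>v ?k" using c(1) by (intro eq_vecI) auto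
    then show False using c(2) by simp
  qed
  from det_non_zero_imp_unit[OF R this, unfolded Units_def, of "()"]
  obtain R' where R': "R' \<in> carrier_mat ?k ?k" and RR': "R * R' = 1\<^sub>m ?k"
    by (auto simp: ring_mat_def)
  \<comment> \<open>Solving \<open>R c = y\<close> for the entries \<open>y\<close> of
    \<open>x\<close> on \<open>U\<close> makes \<open>comb c\<close> agree with \<open>x\<close>
    there.\<close>
  define y where "y = vec ?k (\<lambda>i. ?c (x $ u i))"
  define c where "c = R' *\<^sub>v y"
  have y: "y \<in> carrier_vec ?k" by (simp add: y_def)
  have c: "c \<in> carrier_vec ?k" using R' y by (simp add: c_def)
  have Rc: "R *\<^sub>v c = y"
    using assoc_mult_mat_vec[OF R R' y] RR' y by (simp add: c_def)
  let ?x = "map_vec ?c x"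
  have cx: "?x \<in> carrier_vec n" using x by simp
  note combD = mat_kernelD[OF cM comb_kernel]
  have "?x - comb c = 0\<^sub>v n"
  proof (rule injC)
    show "?x - comb c \<in> carrier_vec n" using cx combD by auto
    fix i assume i: "i < n" "i \<notin> U"
    have "?cM *\<^sub>v (?x - comb c) = ?cM *\<^sub>v ?x - ?cM *\<^sub>v comb c"
      by (rule mult_minus_distrib_mat_vec[OF cM cx combD(1)])
    also have "\<dots> = ?cM *\<^sub>v ?x" using combD(2) cM cx by simp
    also have "?cM *\<^sub>v ?x = map_vec ?c (M *\<^sub>v x)"
      by (rule of_real_hom.mult_mat_vec_hom[OF M x, symmetric])
    finally show "(?cM *\<^sub>v (?x - comb c)) $ i = 0"
      using rows[OF i] i M by (simp add: M_def)
  next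
    fix i assume "i \<in> U"
    then obtain j where j: "j < ?k" "i = u j"
      using u by (force simp: bij_betw_def)
    then have "comb c $ i = ?x $ i"
      using comb_U[OF j(1) c] un[OF j(1)] x by (simp add: Rc y_def)
    then show "(?x - comb c) $ i = 0"
      using j un[OF j(1)] combD(1)[of c] cx by simp
  qed
  then have "(?x - comb c) $ i = 0" if "i < n" for i using that by simp
  then have "?x = comb c"
    using cx combD(1)[of c] by (intro eq_vecI) auto
  then have "?cM *\<^sub>v ?x = 0\<^sub>v n" using combD(2) by simp
  then have "M *\<^sub>v map_vec Re ?x = 0\<^sub>v n"
    using complex_mult_vec_zero_iff[OF M cx] by simp
  moreover have "map_vec Re ?x = x" by (rule eq_vecI) auto
  ultimately show ?thesis by (simp add: M_def)
qed

section \<open>Paths and determinants in forests\<close>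

lemma is_path_iff_successively:
  "is_path A S xs \<longleftrightarrow> xs \<noteq> [] \<and> distinct xs \<and> set xs \<subseteq> S \<and> successively (adj A) xs"
  by (auto simp: is_path_def successively_conv_nth)

lemma is_path_singleton [simp]: "is_path A S [u] \<longleftrightarrow> u \<in> S"
  by (simp add: is_path_iff_successively)

lemma is_path_mono: "is_path A S xs \<Longrightarrow> set xs \<subseteq> T \<Longrightarrow> is_path A T xs"
  by (simp add: is_path_iff_successively)

lemma is_path_prefix: "is_path A S (xs @ ys) \<Longrightarrow> xs \<noteq> [] \<Longrightarrow> is_path A S xs"
  by (simp add: is_path_iff_successively successively_append_iff)

lemma is_path_suffix: "is_path A S (xs @ ys) \<Longrightarrow> ys \<noteq> [] \<Longrightarrow> is_path A S ys"
  by (simp add: is_path_iff_successively successively_append_iff)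

lemma is_path_snoc_iff:
  "xs \<noteq> [] \<Longrightarrow> is_path A S (xs @ [v]) \<longleftrightarrow>
     is_path A S xs \<and> v \<in> S \<and> v \<notin> set xs \<and> adj A (last xs) v"
  by (auto simp: is_path_iff_successively successively_append_iff)

lemma is_path_Cons_iff:
  "xs \<noteq> [] \<Longrightarrow> is_path A S (v # xs) \<longleftrightarrow>
     v \<in> S \<and> v \<notin> set xs \<and> adj A v (hd xs) \<and> is_path A (S - {v}) xs"
  by (cases xs) (auto simp: is_path_iff_successively)

lemma path_weight_snoc:
  assumes "xs \<noteq> []"
  shows "path_weight A (xs @ [v]) = path_weight A xs * A $$ (last xs, v)"
proof -
  obtain m where m: "length xs = Suc m" using assms by (cases xs) auto
  have "last xs = xs ! m" using assms m by (simp add: last_conv_nth)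
  then show ?thesis by (simp add: path_weight_def m nth_append)
qed

text \<open>Walks rather than paths: they concatenate without any care for repeated vertices. The
  closure is reflexive even outside \<open>S\<close>, so \<open>a \<in> S\<close> has to be assumed
  when a path is extracted.\<close>

definition reach :: "real mat \<Rightarrow> nat set \<Rightarrow> nat \<Rightarrow> nat \<Rightarrow> bool" where
  "reach A S = (\<lambda>x y. x \<in> S \<and> y \<in> S \<and> adj A x y)\<^sup>*\<^sup>*"

lemma reach_path:
  assumes "reach A S a b" and a: "a \<in> S"
  shows "\<exists>xs. is_path A S xs \<and> hd xs = a \<and> last xs = b"
  using assms(1) unfolding reach_def
proof induction
  case base
  show ?case using a by (intro exI[of _ "[a]"]) simp
next
  case (step y z)
  then obtain xs where xs: "is_path A S xs" "hd xs = a" "last xs = y" by auto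
  have ne: "xs \<noteq> []" using xs by (simp add: is_path_def)
  show ?case
  proof (cases "z \<in> set xs")
    \<comment> \<open>The walk returns to a vertex of the path, so the path is cut off
      there.\<close>
    case True
    then obtain ys zs where "xs = (ys @ [z]) @ zs"
      by (metis append.assoc append_Cons append_Nil split_list)
    moreover from this have "hd (ys @ [z]) = a" using xs(2) by (cases ys) auto
    ultimately show ?thesis
      using is_path_prefix[of A S "ys @ [z]" zs] xs(1) by (intro exI[of _ "ys @ [z]"]) simp
  next
    case False
    then show ?thesis
      using step xs ne by (intro exI[of _ "xs @ [z]"]) (simp add: is_path_snoc_iff)
  qed
qed

lemma path_reach: "is_path A S xs \<Longrightarrow> reach A S (hd xs) (last xs)"
proof (induction xs)
  case (Cons x xs)
  show ?case
  proof (cases "xs = []")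
    case False
    then have x: "x \<in> S" "adj A x (hd xs)" "is_path A (S - {x}) xs"
      using Cons.prems by (auto simp: is_path_Cons_iff)
    then have "is_path A S xs" by (auto simp: is_path_iff_successively)
    moreover from this have "hd xs \<in> S" using False by (auto simp: is_path_def)
    ultimately show ?thesis
      using Cons.IH x False unfolding reach_def by (simp add: converse_rtranclp_into_rtranclp)
  qed (simp add: reach_def)
qed (simp add: is_path_def)

locale acyclic_symmetric =
  fixes A :: "real mat" and n :: nat
  assumes carrier: "A \<in> carrier_mat n n"
    and symmetric: "A\<^sup>T = A"
    and acyclic: "acyclic_mat A"
begin

lemma entry_sym: "i < n \<Longrightarrow> j < n \<Longrightarrow> A $$ (i, j) = A $$ (j, i)"
  using arg_cong[OF symmetric, of "\<lambda>B. B $$ (i, j)"] carrier by simp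

lemma no_cycle: "\<not> is_cycle A {0..<n} xs"
  using acyclic carrier by (auto simp: acyclic_mat_def)

lemma reach_sym:
  assumes "S \<subseteq> {0..<n}" "reach A S a b"
  shows "reach A S b a"
proof -
  have "symp (\<lambda>x y. x \<in> S \<and> y \<in> S \<and> adj A x y)"
    using assms(1) by (auto intro!: sympI simp: adj_def entry_sym subset_iff)
  then show ?thesis
    using assms(2) unfolding reach_def by (metis symp_rtranclp sympD)
qed

text \<open>A path in \<open>T\<close> between two distinct neighbours of \<open>w\<close> would
  close up through \<open>w\<close> to a cycle. This serves both the uniqueness of paths and the
  uniqueness of the parent of a vertex.\<close>

lemma no_fork:
  assumes T: "T \<subseteq> {0..<n}" and w: "w < n" "w \<notin> T"
    and a: "a \<in> T" "adj A w a" and b: "adj A w b" and ab: "reach A T a b"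
  shows "a = b"
proof (rule ccontr)
  assume "a \<noteq> b"
  obtain xs where xs: "is_path A T xs" "hd xs = a" "last xs = b"
    using reach_path[OF ab a(1)] by blast
  have ne: "xs \<noteq> []" using xs by (simp add: is_path_def)
  have xsT: "set xs \<subseteq> T" using xs by (simp add: is_path_def)
  then have "b \<in> T" using xs ne by auto
  then have "adj A b w" using b T w entry_sym[of b w] by (auto simp: adj_def)
  moreover have "is_path A {0..<n} (w # xs)"
  proof -
    have "set xs \<subseteq> {0..<n} - {w}" using xsT T w by auto
    then show ?thesis
      using is_path_mono[OF xs(1)] ne w a xs by (auto simp: is_path_Cons_iff)
  qed
  moreover have "length xs \<ge> 2"
  proof -
    have "xs \<noteq> [x]" for x using xs \<open>a \<noteq> b\<close> by auto
    then show ?thesis using ne by (cases xs rule: list.exhaust; cases "tl xs") auto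
  qed
  ultimately have "is_cycle A {0..<n} (w # xs)"
    using xs ne by (simp add: is_cycle_def)
  then show False using no_cycle by blast
qed

text \<open>Once the common first vertex \<open>x\<close> is removed, the two second vertices are
  still connected through the common end, so \<open>no_fork\<close> identifies them. The induction
  continues in \<open>S - {x}\<close>, which is why \<open>S\<close> is generalised.\<close>

lemma path_unique:
  assumes "S \<subseteq> {0..<n}" "is_path A S xs" "is_path A S ys" "hd xs = hd ys" "last xs = last ys"
  shows "xs = ys"
  using assms
proof (induction xs arbitrary: S ys)
  case Nil
  then show ?case by (simp add: is_path_def)
next
  case (Cons x xs)
  obtain ys' where ys: "ys = x # ys'"
    using Cons.prems by (cases ys) (auto simp: is_path_def)
  \<comment> \<open>By distinctness only a one-vertex path ends where it begins, so either both
    tails are empty or neither is.\<close>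
  have xs_last: "xs \<noteq> [] \<Longrightarrow> last xs \<noteq> x" and ys_last: "ys' \<noteq> [] \<Longrightarrow> last ys' \<noteq> x"
    using Cons.prems ys by (auto simp: is_path_def)
  show ?case
  proof (cases "xs = []")
    case True
    then show ?thesis using ys ys_last Cons.prems by (cases "ys' = []") auto
  next
    case False
    then have ne: "ys' \<noteq> []" using ys xs_last Cons.prems by auto
    have S: "S - {x} \<subseteq> {0..<n}" using Cons.prems by auto
    have last: "last xs = last ys'" using Cons.prems ys ne False by simp
    have px: "x \<in> S" "adj A x (hd xs)" "is_path A (S - {x}) xs"
      using Cons.prems(2) False by (auto simp: is_path_Cons_iff)
    have py: "adj A x (hd ys')" "is_path A (S - {x}) ys'"
      using Cons.prems(3) ys ne by (auto simp: is_path_Cons_iff)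
    have "reach A (S - {x}) (hd xs) (last ys')"
      using path_reach[OF px(3)] last by simp
    then have "reach A (S - {x}) (hd xs) (hd ys')"
      using reach_sym[OF S path_reach[OF py(2)]] unfolding reach_def by (rule rtranclp_trans)
    moreover have "hd xs \<in> S - {x}" using px(3) hd_in_set[OF False] unfolding is_path_def by blast
    ultimately have "hd xs = hd ys'"
      using no_fork[OF S, of x] px py Cons.prems(1) by auto
    then show ?thesis using Cons.IH[OF S px(3) py(2) _ last] ys by simp
  qed
qed

section \<open>Characteristic polynomials of forests\<close>

definition lam_det :: "real \<Rightarrow> nat set \<Rightarrow> real" where
  "lam_det lam = set_det (\<lambda>i j. (if i = j then lam else 0) - A $$ (i, j))"

lemma phi_principal_eq: "S \<subseteq> {0..<n} \<Longrightarrow> phi (principal A S) lam = lam_det lam S"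
  unfolding lam_det_def by (rule phi_principal[OF carrier])

text \<open>The orbit of \<open>w\<close> has at least three elements. Were all entries along it
  nonzero, listing the orbit would give a cycle of the graph.\<close>

lemma permutation_long_cycle_entry:
  assumes X: "X \<subseteq> {0..<n}" and w: "w \<in> X"
    and p: "p permutes X" "p w \<noteq> w" "p (p w) \<noteq> w"
  shows "\<exists>i\<in>X. p i \<noteq> i \<and> A $$ (i, p i) = 0"
proof (rule ccontr)
  assume "\<not> ?thesis"
  then have nz: "adj A i (p i)" if "i \<in> X" "p i \<noteq> i" for i
    using that by (auto simp: adj_def)
  have perm: "permutation p"
    using p(1) X by (meson finite_atLeastLessThan finite_subset permutation_permutes)
  \<comment> \<open>The length of the orbit of \<open>w\<close>; the assumptions on
    \<open>p w\<close> and \<open>p (p w)\<close> rule out 1 and 2.\<close>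
  define m where "m = least_power p w"
  have m: "(p ^^ m) w = w" "m > 0"
    using least_power_of_permutation[OF perm] by (simp_all add: m_def)
  have "m \<noteq> 1" "m \<noteq> 2" using m p by (auto simp: numeral_2_eq_2)
  then have m3: "m \<ge> 3" using m(2) by linarith
  define xs where "xs = support p w"
  have len: "length xs = m" by (simp add: xs_def m_def)
  have nth: "xs ! i = (p ^^ i) w" if "i < m" for i
    using that by (simp add: xs_def m_def)
  have dist: "distinct xs"
    using cycle_of_permutation[OF perm] by (simp add: xs_def)
  have inX: "(p ^^ i) w \<in> X" for i
    by (induction i) (use w permutes_in_image[OF p(1)] in auto)
  have step: "adj A (xs ! i) (xs ! Suc i)" if "Suc i < m" for i
  proof -
    have "xs ! i \<noteq> xs ! Suc i" using dist that len by (simp add: nth_eq_iff_index_eq)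
    then show ?thesis using nz[OF inX[of i]] that by (simp add: nth)
  qed
  have "adj A (last xs) (hd xs)"
  proof -
    have ne: "xs \<noteq> []" using len m(2) by auto
    have l: "last xs = (p ^^ (m - 1)) w" and h: "hd xs = w"
      using m(2) nth[of "m - 1"] nth[of 0] ne by (simp_all add: last_conv_nth hd_conv_nth len)
    have "p ((p ^^ (m - 1)) w) = w"
      using m by (cases m) auto
    moreover have "(p ^^ (m - 1)) w \<noteq> w"
      using dist nth_eq_iff_index_eq[of xs "m - 1" 0] nth[of "m - 1"] nth[of 0] m3 len by simp
    ultimately show ?thesis using nz[OF inX[of "m - 1"]] l h by simp
  qed
  moreover have "is_path A {0..<n} xs"
    using len m(2) dist step X inX unfolding is_path_def xs_def by auto
  ultimately have "is_cycle A {0..<n} xs" using len m3 by (simp add: is_cycle_def)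
  then show False using no_cycle by blast
qed

text \<open>The vertex deletion recurrence of forests. The two minus signs off the diagonal cancel,
  and symmetry turns the product into a square.\<close>

lemma lam_det_expand:
  assumes X: "X \<subseteq> {0..<n}" and w: "w \<in> X"
  shows "lam_det lam X = (lam - A $$ (w, w)) * lam_det lam (X - {w})
          - (\<Sum>c\<in>X - {w}. (A $$ (w, c))\<^sup>2 * lam_det lam (X - {w, c}))"
proof -
  let ?M = "\<lambda>i j. (if i = j then lam else 0) - A $$ (i, j)"
  have fin: "finite X" using X by (rule finite_subset) simp
  have "lam_det lam X = ?M w w * lam_det lam (X - {w})
      - (\<Sum>c\<in>X - {w}. ?M w c * ?M c w * lam_det lam (X - {w, c}))"
    unfolding lam_det_def
  proof (rule set_det_expand[OF fin w])
    fix p assume "p permutes X" "p w \<noteq> w" "p (p w) \<noteq> w"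
    from permutation_long_cycle_entry[OF X w this]
    obtain i where "i \<in> X" "p i \<noteq> i" "A $$ (i, p i) = 0" by blast
    then show "\<exists>i\<in>X. ?M i (p i) = 0" by (intro bexI[of _ i]) simp_all
  qed
  also have "(\<Sum>c\<in>X - {w}. ?M w c * ?M c w * lam_det lam (X - {w, c}))
      = (\<Sum>c\<in>X - {w}. (A $$ (w, c))\<^sup>2 * lam_det lam (X - {w, c}))"
  proof (rule sum.cong[OF refl])
    fix c assume "c \<in> X - {w}"
    then have "c < n" "w < n" "c \<noteq> w" using X w by auto
    then show "?M w c * ?M c w * lam_det lam (X - {w, c})
        = (A $$ (w, c))\<^sup>2 * lam_det lam (X - {w, c})"
      using entry_sym[of c w] by (simp add: power2_eq_square)
  qed
  finally show ?thesis by simp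
qed

text \<open>Induction on \<open>X\<close>: both sides are expanded at a vertex \<open>w\<close> of
  \<open>X\<close> by the recurrence, and the neighbours \<open>c\<close> in \<open>Y\<close> drop
  out because their entries with \<open>w\<close> vanish.\<close>

lemma lam_det_disconnected:
  assumes "X \<subseteq> {0..<n}" "Y \<subseteq> {0..<n}" "X \<inter> Y = {}"
    and "\<And>x y. x \<in> X \<Longrightarrow> y \<in> Y \<Longrightarrow> A $$ (x, y) = 0"
  shows "lam_det lam (X \<union> Y) = lam_det lam X * lam_det lam Y"
  using assms
proof (induction "card X" arbitrary: X rule: less_induct)
  case less
  have fin: "finite X" "finite Y" using less.prems by (auto intro: finite_subset)
  show ?case
  proof (cases "X = {}")
    case True
    then show ?thesis by (simp add: lam_det_def)
  next
    case False
    then obtain w where w: "w \<in> X" by blast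
    have IH: "lam_det lam (X' \<union> Y) = lam_det lam X' * lam_det lam Y" if "X' \<subset> X" for X'
      using that less.prems psubset_card_mono[OF fin(1) that] by (intro less.hyps) auto
    have Xw: "(X \<union> Y) - {w} = (X - {w}) \<union> Y" using w less.prems(3) by auto
    have "lam_det lam (X \<union> Y) = (lam - A $$ (w, w)) * lam_det lam ((X - {w}) \<union> Y)
        - (\<Sum>c\<in>(X - {w}) \<union> Y. (A $$ (w, c))\<^sup>2 * lam_det lam ((X \<union> Y) - {w, c}))"
      using lam_det_expand[of "X \<union> Y" w lam] w less.prems unfolding Xw by auto
    also have "(\<Sum>c\<in>(X - {w}) \<union> Y. (A $$ (w, c))\<^sup>2 * lam_det lam ((X \<union> Y) - {w, c}))
        = (\<Sum>c\<in>X - {w}. (A $$ (w, c))\<^sup>2 * lam_det lam ((X \<union> Y) - {w, c}))"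
      using fin less.prems(4)[OF w] by (intro sum.mono_neutral_right) auto
    also have "\<dots> = (\<Sum>c\<in>X - {w}. (A $$ (w, c))\<^sup>2 * lam_det lam (X - {w, c})) * lam_det lam Y"
      unfolding sum_distrib_right
    proof (rule sum.cong[OF refl])
      fix c assume "c \<in> X - {w}"
      then have "(X \<union> Y) - {w, c} = (X - {w, c}) \<union> Y" "X - {w, c} \<subset> X"
        using w less.prems(3) by auto
      then show "(A $$ (w, c))\<^sup>2 * lam_det lam ((X \<union> Y) - {w, c})
          = (A $$ (w, c))\<^sup>2 * lam_det lam (X - {w, c}) * lam_det lam Y"
        using IH by simp
    qed
    also have "lam_det lam ((X - {w}) \<union> Y) = lam_det lam (X - {w}) * lam_det lam Y"
      using w by (intro IH) auto
    finally show ?thesis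
      unfolding lam_det_expand[OF less.prems(1) w] by (simp only: left_diff_distrib mult.assoc)
  qed
qed

end

section \<open>Eigenvectors from star sets\<close>

lemma char_matrix_mult_vec_index:
  fixes A :: "'a :: field mat"
  assumes A: "A \<in> carrier_mat n n" and z: "z \<in> carrier_vec n" and i: "i < n"
  shows "(char_matrix A lam *\<^sub>v z) $ i = (\<Sum>j<n. A $$ (i, j) * z $ j) - lam * z $ i"
proof -
  have "(char_matrix A lam *\<^sub>v z) $ i = (\<Sum>j<n. (A $$ (i, j) - (if i = j then lam else 0)) * z $ j)"
    using A z i by (auto intro!: sum.cong simp: char_matrix_def scalar_prod_def atLeast0LessThan)
  also have "\<dots> = (\<Sum>j<n. A $$ (i, j) * z $ j) - (\<Sum>j<n. if i = j then lam * z $ j else 0)"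
    unfolding sum_subtractf[symmetric] by (rule sum.cong) (auto simp: algebra_simps)
  also have "(\<Sum>j<n. if i = j then lam * z $ j else 0) = lam * z $ i"
    using i by simp
  finally show ?thesis .
qed

lemma phi_nonzero_if_not_eigenvalue:
  assumes B: "B \<in> carrier_mat m m" and "\<not> eigenvalue B lam"
  shows "phi B lam \<noteq> 0"
proof -
  \<comment> \<open>\<open>char_matrix\<close> is the matrix minus \<open>lam\<close> times the
    identity, opposite in sign to the matrix in \<open>phi\<close>.\<close>
  have "- char_matrix B lam = lam \<cdot>\<^sub>m 1\<^sub>m (dim_row B) - B"
    using B by (intro eq_matI) (auto simp: char_matrix_def)
  then show ?thesis
    using assms det_0_negate[OF char_matrix_closed[OF B, of lam]]
    by (simp add: phi_def eigenvalue_det[OF B])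
qed

text \<open>A nonzero \<open>z\<close> of this kind would restrict to an eigenvector of the
  submatrix outside \<open>U\<close>. This supplies the hypothesis \<open>inj\<close> of
  \<open>symmetric_kernel_by_rows\<close>.\<close>

lemma principal_not_eigenvalue_rows:
  fixes A :: "real mat"
  assumes A: "A \<in> carrier_mat n n" and U: "U \<subseteq> {0..<n}"
    and noteig: "\<not> eigenvalue (principal A ({0..<n} - U)) lam"
    and z: "z \<in> carrier_vec n"
    and rows: "\<And>i. i < n \<Longrightarrow> i \<notin> U \<Longrightarrow> (char_matrix A lam *\<^sub>v z) $ i = 0"
    and zU: "\<And>i. i \<in> U \<Longrightarrow> z $ i = 0"
  shows "z = 0\<^sub>v n"
proof (rule ccontr)
  assume nz: "z \<noteq> 0\<^sub>v n"
  let ?N = "{0..<n} - U"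
  let ?B = "principal A ?N" and ?m = "card ?N"
  have bij: "bij_betw (pick ?N) {0..<?m} ?N" by (rule bij_betw_pick) simp
  note B = principal_carrier_entry[OF A, of ?N, simplified]
  define v where "v = vec ?m (\<lambda>i. z $ pick ?N i)"
  have v: "v \<in> carrier_vec ?m" by (simp add: v_def)
  have pickN: "pick ?N i < n" "pick ?N i \<notin> U" if "i < ?m" for i
    using bij_betwE[OF bij] that by auto
  have "?B *\<^sub>v v = lam \<cdot>\<^sub>v v"
  proof (rule eq_vecI)
    fix i assume "i < dim_vec (lam \<cdot>\<^sub>v v)"
    then have i: "i < ?m" by (simp add: v_def)
    have "(?B *\<^sub>v v) $ i = (\<Sum>j\<in>{0..<?m}. A $$ (pick ?N i, pick ?N j) * z $ pick ?N j)"
      using i B by (auto intro!: sum.cong simp: scalar_prod_def v_def)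
    also have "\<dots> = (\<Sum>j\<in>?N. A $$ (pick ?N i, j) * z $ j)"
      by (rule sum.reindex_bij_betw[OF bij])
    also have "\<dots> = (\<Sum>j<n. A $$ (pick ?N i, j) * z $ j)"
      using zU by (intro sum.mono_neutral_left) auto
    also have "\<dots> = lam * z $ pick ?N i"
      using char_matrix_mult_vec_index[OF A z pickN(1)[OF i], of lam] rows[OF pickN[OF i]] by simp
    finally show "(?B *\<^sub>v v) $ i = (lam \<cdot>\<^sub>v v) $ i" using i by (simp add: v_def)
  qed (use B v in auto)
  moreover have "v \<noteq> 0\<^sub>v ?m"
  proof
    assume v0: "v = 0\<^sub>v ?m"
    have "z $ j = 0" if j: "j < n" for j
    proof (cases "j \<in> U")
      case False
      then have "j \<in> ?N" using j by simp
      then have "j \<in> pick ?N ` {0..<?m}" unfolding bij_betw_imp_surj_on[OF bij] .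
      then obtain i where i: "i \<in> {0..<?m}" "j = pick ?N i" by blast
      have "v $ i = 0" using i(1) unfolding v0 by simp
      then show ?thesis using i by (simp add: v_def)
    qed (rule zU)
    then show False using nz z by (auto intro: eq_vecI)
  qed
  ultimately have "eigenvalue ?B lam"
    using B(1) v unfolding eigenvalue_def eigenvector_def by auto
  then show False using noteig by blast
qed

section \<open>Components and the vectors built from their paths\<close>

context acyclic_symmetric
begin

lemma component_subset: "component A S u \<subseteq> S"
  by (force simp: component_def is_path_def)

text \<open>Every prefix of a path from \<open>u\<close> ends in the component, so the path never
  leaves it. This matters because \<open>alpha\<close> takes its paths inside the component.\<close>

lemma component_path:
  assumes "v \<in> component A S u"
  shows "\<exists>xs. is_path A (component A S u) xs \<and> hd xs = u \<and> last xs = v"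
proof -
  obtain xs where xs: "is_path A S xs" "hd xs = u" "last xs = v"
    using assms by (auto simp: component_def)
  have "x \<in> component A S u" if x: "x \<in> set xs" for x
  proof -
    obtain ys zs where "xs = ys @ x # zs" using split_list[OF x] by blast
    then have eq: "xs = (ys @ [x]) @ zs" by simp
    then have "hd (ys @ [x]) = u" using xs(2) by (cases ys) auto
    moreover have "is_path A S (ys @ [x])" using is_path_prefix xs(1) eq by blast
    ultimately show ?thesis unfolding component_def by force
  qed
  then show ?thesis using is_path_mono[OF xs(1)] xs by blast
qed

lemma component_closed:
  assumes v: "v \<in> component A S u" and w: "w \<in> S" "adj A v w"
  shows "w \<in> component A S u"
proof -
  obtain xs where xs: "is_path A (component A S u) xs" "hd xs = u" "last xs = v"
    using component_path[OF v] by blast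
  have ne: "xs \<noteq> []" using xs by (simp add: is_path_def)
  show ?thesis
  proof (cases "w \<in> set xs")
    case True
    then show ?thesis using xs by (auto simp: is_path_def)
  next
    case False
    have "is_path A S xs"
      using is_path_mono[OF xs(1)] xs(1) component_subset unfolding is_path_def by blast
    then have "is_path A S (xs @ [w])" using False w xs ne by (simp add: is_path_snoc_iff)
    moreover have "hd (xs @ [w]) = u" using ne xs by simp
    ultimately show ?thesis unfolding component_def by force
  qed
qed

lemma the_path_eqI:
  assumes S: "S \<subseteq> {0..<n}" and xs: "is_path A S xs" "hd xs = u" "last xs = v"
  shows "the_path A S u v = xs"
  unfolding the_path_def using xs path_unique[OF S] by (intro the_equality) auto

text \<open>The nonzero branch of \<open>alpha\<close>, with \<open>phi\<close> of the submatrix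
  replaced by \<open>lam_det\<close>.\<close>

definition path_vec :: "real \<Rightarrow> nat set \<Rightarrow> nat \<Rightarrow> nat \<Rightarrow> real" where
  "path_vec lam C u v = path_weight A (the_path A C u v) * lam_det lam (C - set (the_path A C u v))"

lemma path_vec_eqI:
  assumes "C \<subseteq> {0..<n}" "is_path A C xs" "hd xs = u" "last xs = v"
  shows "path_vec lam C u v = path_weight A xs * lam_det lam (C - set xs)"
  unfolding path_vec_def the_path_eqI[OF assms] ..

text \<open>With \<open>Q\<close> the path from \<open>u\<close> to the parent \<open>p\<close> of
  \<open>w\<close>, the entries at \<open>p\<close>, \<open>w\<close> and the children of
  \<open>w\<close> all carry the weight \<open>W\<close> of \<open>Q\<close>. The recurrence for
  \<open>R = C - set Q\<close> at \<open>w\<close> evaluates the sum over the children.\<close>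

lemma path_vec_row:
  assumes S: "S \<subseteq> {0..<n}" and C_def: "C = component A S u"
    and w: "w \<in> C" and wu: "w \<noteq> u"
  shows "(\<Sum>v\<in>C. A $$ (w, v) * path_vec lam C u v) = lam * path_vec lam C u w"
proof -
  let ?\<alpha> = "path_vec lam C u"
  have C: "C \<subseteq> {0..<n}" using component_subset S unfolding C_def by blast
  have finC: "finite C" using C by (rule finite_subset) simp
  obtain xs where xs: "is_path A C xs" "hd xs = u" "last xs = w"
    using component_path w unfolding C_def by blast
  then obtain Q where xsQ: "xs = Q @ [w]"
    by (metis append_butlast_last_id is_path_def)
  have Qne: "Q \<noteq> []" using xs xsQ wu by auto
  define p where "p = last Q"
  have Q: "is_path A C Q" "w \<notin> set Q" "adj A p w" "hd Q = u"
    using xs Qne unfolding xsQ by (auto simp: is_path_snoc_iff p_def)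
  have QC: "set Q \<subseteq> C" and pQ: "p \<in> set Q" using Q Qne by (auto simp: is_path_def p_def)
  define R where "R = C - set Q"
  define W where "W = path_weight A Q"
  have wn: "w < n" using w C by auto
  have pn: "p < n" using pQ QC C by auto
  have \<alpha>p: "?\<alpha> p = W * lam_det lam R"
    unfolding W_def R_def by (rule path_vec_eqI[OF C Q(1,4)]) (simp add: p_def)
  have Wxs: "path_weight A xs = W * A $$ (p, w)"
    using path_weight_snoc[OF Qne] by (simp add: xsQ W_def p_def)
  have Cxs: "C - set xs = R - {w}" unfolding R_def xsQ by auto
  have \<alpha>w: "?\<alpha> w = W * A $$ (p, w) * lam_det lam (R - {w})"
    using path_vec_eqI[OF C xs] Wxs Cxs by simp
  \<comment> \<open>Stated for every \<open>c\<close> in \<open>R - {w}\<close>, to match the sum in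
    the recurrence: both sides are zero unless \<open>c\<close> is a neighbour, and then the path to
    \<open>c\<close> prolongs the one to \<open>w\<close>.\<close>
  have \<alpha>c: "A $$ (w, c) * ?\<alpha> c = W * A $$ (p, w) * ((A $$ (w, c))\<^sup>2 * lam_det lam (R - {w, c}))"
    if c: "c \<in> R - {w}" for c
  proof (cases "A $$ (w, c) = 0")
    case False
    have ne: "xs \<noteq> []" by (simp add: xsQ)
    have "c \<in> C" "c \<notin> set xs" "adj A (last xs) c"
      using c xs(3) False by (auto simp: adj_def R_def xsQ)
    then have "is_path A C (xs @ [c])"
      using xs(1) ne by (simp add: is_path_snoc_iff)
    then have "?\<alpha> c = path_weight A (xs @ [c]) * lam_det lam (C - set (xs @ [c]))"
      using xs ne by (intro path_vec_eqI[OF C]) auto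
    also have "path_weight A (xs @ [c]) = W * A $$ (p, w) * A $$ (w, c)"
      using path_weight_snoc[OF ne] xs Wxs by simp
    also have "C - set (xs @ [c]) = R - {w, c}"
      unfolding R_def xsQ by auto
    finally show ?thesis by (simp add: power2_eq_square)
  qed simp
  \<comment> \<open>\<open>Q\<close> joins \<open>v\<close> to \<open>p\<close> without meeting
    \<open>w\<close>, so a second neighbour of \<open>w\<close> on \<open>Q\<close> would be a
    fork.\<close>
  have rest: "A $$ (w, v) = 0" if v: "v \<in> set Q" "v \<noteq> p" for v
  proof (rule ccontr)
    assume nz: "A $$ (w, v) \<noteq> 0"
    have "adj A w p" using Q(3) entry_sym[OF pn wn] by (auto simp: adj_def)
    moreover have "adj A w v" using nz v Q(2) by (auto simp: adj_def)
    moreover have "reach A (set Q) v p"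
    proof -
      obtain ys zs where eq: "Q = ys @ (v # zs)" using split_list[OF v(1)] by blast
      have "is_path A C (v # zs)" using is_path_suffix Q(1) eq by blast
      moreover have "set (v # zs) \<subseteq> set Q" using eq by auto
      ultimately have "is_path A (set Q) (v # zs)" by (rule is_path_mono)
      from path_reach[OF this] show ?thesis using eq by (simp add: p_def)
    qed
    ultimately show False
      using no_fork[of "set Q" w v p] v wn Q(2) QC C by auto
  qed
  have finR: "finite R" "finite (set Q)" using finC by (simp_all add: R_def)
  have split: "C = set Q \<union> insert w (R - {w})" using QC w Q(2) by (auto simp: R_def)
  have "(\<Sum>v\<in>C. A $$ (w, v) * ?\<alpha> v)
      = (\<Sum>v\<in>set Q. A $$ (w, v) * ?\<alpha> v) + (\<Sum>v\<in>insert w (R - {w}). A $$ (w, v) * ?\<alpha> v)"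
    by (subst split, rule sum.union_disjoint) (use finR Q(2) in \<open>auto simp: R_def\<close>)
  also have "(\<Sum>v\<in>set Q. A $$ (w, v) * ?\<alpha> v) = (\<Sum>v\<in>{p}. A $$ (w, v) * ?\<alpha> v)"
    using pQ rest by (intro sum.mono_neutral_right) auto
  also have "(\<Sum>v\<in>insert w (R - {w}). A $$ (w, v) * ?\<alpha> v)
      = A $$ (w, w) * ?\<alpha> w + (\<Sum>c\<in>R - {w}. A $$ (w, c) * ?\<alpha> c)"
    by (subst sum.insert) (use finR in auto)
  also have "(\<Sum>c\<in>R - {w}. A $$ (w, c) * ?\<alpha> c)
      = W * A $$ (p, w) * (\<Sum>c\<in>R - {w}. (A $$ (w, c))\<^sup>2 * lam_det lam (R - {w, c}))"
    unfolding sum_distrib_left by (rule sum.cong[OF refl \<alpha>c])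
  \<comment> \<open>The recurrence solved for its sum; the term \<open>lam_det lam R\<close> will
    cancel the contribution of the parent.\<close>
  also have "(\<Sum>c\<in>R - {w}. (A $$ (w, c))\<^sup>2 * lam_det lam (R - {w, c}))
      = (lam - A $$ (w, w)) * lam_det lam (R - {w}) - lam_det lam R"
  proof -
    have "R \<subseteq> {0..<n}" "w \<in> R" using w Q(2) C by (auto simp: R_def)
    from lam_det_expand[OF this, of lam] show ?thesis by simp
  qed
  finally show ?thesis
    by (simp add: \<alpha>w \<alpha>p entry_sym[OF wn pn] algebra_simps)
qed

lemma path_vec_root:
  assumes "S \<subseteq> {0..<n}" "u \<in> S"
  shows "u \<in> component A S u"
    and "path_vec lam (component A S u) u u = lam_det lam (component A S u - {u})"
proof -
  show u: "u \<in> component A S u"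
    unfolding component_def using assms by (auto intro!: exI[of _ "[u]"])
  have "component A S u \<subseteq> {0..<n}" using component_subset assms by blast
  from path_vec_eqI[OF this, of "[u]"] u
  show "path_vec lam (component A S u) u u = lam_det lam (component A S u - {u})"
    by (simp add: path_weight_def)
qed

end

theorem theorem3p8:
  fixes A :: "real mat" and n k :: nat and lam :: real and U :: "nat set"
  assumes "A \<in> carrier_mat n n"
    and "A\<^sup>T = A"
    and "acyclic_mat A"
    and "eigenvalue A lam"
    and "multiplicity A lam = k"
    and "star_set A lam U"
  shows "(\<forall>u\<in>U. eigenvector A (alpha A lam U u) lam) \<and>
         (\<forall>c :: nat \<Rightarrow> real. (\<forall>v<n. (\<Sum>u\<in>U. c u * alpha A lam U u $ v) = 0)
             \<longrightarrow> (\<forall>u\<in>U. c u = 0))"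
proof -
  note A = assms(1)
  interpret acyclic_symmetric A n using assms by unfold_locales
  have dim: "dim_row A = n" using A by simp
  have U: "U \<subseteq> {0..<n}" and card: "card U = Polynomial.order lam (char_poly A)"
    and noteig: "\<not> eigenvalue (principal A ({0..<n} - U)) lam"
    using assms(6) by (simp_all add: star_set_def multiplicity_def dim)
  let ?N = "{0..<n} - U"
  \<comment> \<open>For \<open>u\<close> in \<open>U\<close>, the sets \<open>S u\<close> and
    \<open>C u\<close> index the matrix with the other star vertices deleted and its component at
    \<open>u\<close>.\<close>
  define S where "S = (\<lambda>u. {0..<n} - (U - {u}))"
  define C where "C = (\<lambda>u. component A (S u) u)"
  have S: "S u \<subseteq> {0..<n}" for u by (auto simp: S_def)
  have CS: "C u \<subseteq> S u" for u unfolding C_def by (rule component_subset)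
  have Cn: "C u \<subseteq> {0..<n}" for u using CS S by blast
  have uS: "u \<in> S u" if "u \<in> U" for u using that U by (auto simp: S_def)
  let ?\<alpha> = "alpha A lam U"
  have alpha_carrier: "?\<alpha> u \<in> carrier_vec n" for u
    by (simp add: alpha_def Let_def dim)
  have alpha_index: "?\<alpha> u $ v = (if v \<in> C u then path_vec lam (C u) u v else 0)" if "v < n" for u v
    using that Cn[of u] phi_principal_eq[of "C u - X" lam for X]
    by (auto simp: alpha_def Let_def dim path_vec_def C_def S_def)
  have "lam_det lam ?N \<noteq> 0"
    using phi_nonzero_if_not_eigenvalue[OF principal_carrier_entry(1)[OF A, of ?N] noteig]
    by (simp add: phi_principal_eq)
  \<comment> \<open>No edge of \<open>S u\<close> leaves \<open>C u\<close>, so \<open>?N\<close>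
    splits into \<open>C u - {u}\<close> and a part not joined to it; the determinant of
    \<open>?N\<close> factors accordingly.\<close>
  have alpha_root: "?\<alpha> u $ u \<noteq> 0" if u: "u \<in> U" for u
  proof -
    have CN: "C u - {u} \<subseteq> ?N" using CS[of u] by (auto simp: S_def)
    have "lam_det lam ((C u - {u}) \<union> (?N - C u)) = lam_det lam (C u - {u}) * lam_det lam (?N - C u)"
    proof (rule lam_det_disconnected)
      fix x y assume x: "x \<in> C u - {u}" and y: "y \<in> ?N - C u"
      show "A $$ (x, y) = 0"
      proof (rule ccontr)
        assume "A $$ (x, y) \<noteq> 0"
        then have "y \<in> C u"
          using component_closed[of x "S u" u y] x y by (auto simp: C_def adj_def S_def)
        then show False using y by blast
      qed
    qed (use Cn[of u] in auto)
    moreover have "(C u - {u}) \<union> (?N - C u) = ?N" using CN u by auto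
    ultimately have "lam_det lam (C u - {u}) \<noteq> 0"
      using \<open>lam_det lam ?N \<noteq> 0\<close> by auto
    moreover have "?\<alpha> u $ u = lam_det lam (C u - {u})"
      using path_vec_root[OF S uS[OF u]] u U alpha_index[of u u] by (auto simp: C_def)
    ultimately show ?thesis by simp
  qed
  have alpha_other: "?\<alpha> u $ v = 0" if "u \<in> U" "v \<in> U" "v \<noteq> u" for u v
  proof -
    have "v < n" "v \<notin> C u" using that U CS[of u] by (auto simp: S_def)
    then show ?thesis by (simp add: alpha_index)
  qed
  have rows: "(char_matrix A lam *\<^sub>v ?\<alpha> u) $ w = 0" if u: "u \<in> U" and w: "w < n" "w \<notin> U" for u w
  proof -
    have "(\<Sum>v<n. A $$ (w, v) * ?\<alpha> u $ v) = (\<Sum>v<n. if v \<in> C u then A $$ (w, v) * path_vec lam (C u) u v else 0)"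
      by (rule sum.cong) (auto simp: alpha_index)
    also have "\<dots> = (\<Sum>v\<in>C u. A $$ (w, v) * path_vec lam (C u) u v)"
      using Cn[of u] by (subst sum.inter_restrict[symmetric]) (auto simp: Int_absorb1 atLeast0LessThan)
    also have "\<dots> = lam * ?\<alpha> u $ w"
    proof (cases "w \<in> C u")
      case True
      then show ?thesis
        using path_vec_row[OF S C_def[THEN fun_cong] True] u w by (auto simp: alpha_index)
    next
      \<comment> \<open>As \<open>w\<close> is not in \<open>U\<close> it lies in
        \<open>S u\<close>, and outside the closed set \<open>C u\<close> it has no neighbour in it:
        both sides are zero.\<close>
      case False
      have "A $$ (w, v) = 0" if v: "v \<in> C u" for v
      proof (rule ccontr)
        assume "A $$ (w, v) \<noteq> 0"
        then have "adj A v w"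
          using v False Cn[of u] w entry_sym[of w v] by (auto simp: adj_def)
        then have "w \<in> C u"
          using component_closed[of v "S u" u w] v w by (auto simp: C_def S_def)
        then show False using False by blast
      qed
      then show ?thesis using False w by (simp add: alpha_index)
    qed
    finally show ?thesis
      using char_matrix_mult_vec_index[OF A alpha_carrier w(1)] by simp
  qed
  have "eigenvector A (?\<alpha> u) lam" if u: "u \<in> U" for u
  proof -
    have "char_matrix A lam *\<^sub>v ?\<alpha> u = 0\<^sub>v n"
    proof (rule symmetric_kernel_by_rows[OF A assms(2) U card])
      show "z = 0\<^sub>v n" if "z \<in> carrier_vec n"
        "\<And>i. i < n \<Longrightarrow> i \<notin> U \<Longrightarrow> (char_matrix A lam *\<^sub>v z) $ i = 0" "\<And>i. i \<in> U \<Longrightarrow> z $ i = 0" for z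
        using principal_not_eigenvalue_rows[OF A U noteig that] .
    qed (use alpha_carrier rows[OF u] in auto)
    moreover have "?\<alpha> u \<noteq> 0\<^sub>v n" using alpha_root[OF u] u U by auto
    ultimately show ?thesis
      using alpha_carrier by (simp add: eigenvector_char_matrix[OF A])
  qed
  moreover have "c u = 0" if c: "\<forall>v<n. (\<Sum>u\<in>U. c u * ?\<alpha> u $ v) = 0" and u: "u \<in> U" for c u
  proof -
    have finU: "finite U" using U by (rule finite_subset) simp
    \<comment> \<open>At coordinate \<open>u\<close> only the vector belonging to \<open>u\<close>
      is nonzero, so this coordinate isolates \<open>c u\<close>.\<close>
    have "(\<Sum>u'\<in>U. c u' * ?\<alpha> u' $ u) = (\<Sum>u'\<in>{u}. c u' * ?\<alpha> u' $ u)"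
      using u finU alpha_other by (intro sum.mono_neutral_right) auto
    then show ?thesis using c alpha_root[OF u] u U by auto
  qed
  ultimately show ?thesis by blast
qed

end
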